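(* Let $v\in\mathbb C^n\setminus\{0\}$ and let $M_v=USU^t$ be an eigenvalue decomposition where $U=[u^{(1)},\dots,u^{(2n)}]\in\mathbb R^{2n\times 2n}$ is an orthogonal matrix with first two columns $u^{(1)}=\frac{v_R}{\|v\|}$, $u^{(2)}=\frac{v_I}{\|v\|}$, and $S=\mathrm{diag}(d,d,1,\dots,1)$. Let $\hat u_1=\sqrt S\,U^t\frac{v_R}{\sqrt d\,\|v\|}$ and let $Q\in\mathbb R^{2n\times2n}$ be the orthogonal factor of a rank-revealing QR-decomposition $I_{2n}-\hat u_1\hat u_1^t=QRP$, where $R$ is upper triangular and $P$ is a permutation matrix. Let $$u_{R,1}=\frac{v_R}{\sqrt d\,\|v\|},\qquad u_{R,i}=U\sqrt{S^{-1}}\,Q_{[:,i-1]},\quad i=2,\dots,2n.$$ Then the vectors $u_i=(u_{R,i})_{[1:n]}+\mathbf i\,(u_{R,i})_{[n+1:2n]}\in\mathbb C^n$, $i=1,\dots,2n$, form an orthonormal $\mathbb R$-basis of $\mathbb C^n$ for the inner product $\langle\cdot,\cdot\rangle_v$.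
   Context: $d>2$ is an integer. For $v\in\mathbb C^n\setminus\{0\}$, the real inner product $\langle\cdot,\cdot\rangle_v$ on $\mathbb C^n\sim\mathbb R^{2n}$ is $\langle u,u'\rangle_v=\Re\big(u^*u'+(d-1)(u^*v)(v^*u')\|v\|^{-2}\big)$ (${}^*$ denotes conjugate transpose). Identifying $u\in\mathbb C^n$ with $(\Re(u);\Im(u))\in\mathbb R^{2n}$, its matrix in the canonical basis of $\mathbb R^{2n}$ is $$M_v=I_{2n}+(d-1)\|v\|^{-2}(v_Rv_R^t+v_Iv_I^t),$$ where $v_R=(\Re(v);\Im(v))$, $v_I=(-\Im(v);\Re(v))$ in $\mathbb R^{2n}$. The notation $Q_{[:,j]}$ is the $j$-th column of $Q$ and $x_{[a:b]}$ is the subvector of $x$ of entries $a,\dots,b$. $\sqrt S$ and $\sqrt{S^{-1}}$ are the positive diagonal square roots. A rank-revealing QR-decomposition of a matrix $A$ of rank $\rho$ is a factorization $A=QRP$ with $Q$ orthogonal, $P$ a permutation matrix and $R$ upper triangular whose leading $\rho\times\rho$ block is invertible and whose rows after the $\rho$-th are zero (so the first $\rho$ columns of $Q$ span the image of $A$). *)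

theory Defs
  imports Complex_Main "Jordan_Normal_Form.DL_Rank"
    "Jordan_Normal_Form.Gauss_Jordan_Elimination"
begin

text \<open>Vectors and matrices are those of \<^theory>\<open>Jordan_Normal_Form.Matrix\<close>, whose
  entries, rows and columns are indexed from 0.\<close>

subsection \<open>The inner product on complex space and its real matrix\<close>

definition cvec_norm :: "complex vec \<Rightarrow> real" where
  "cvec_norm v = sqrt (\<Sum>i<dim_vec v. (cmod (v $ i))\<^sup>2)"

text \<open>The library product conjugates its second argument, so that \<open>w \<bullet>c u\<close> is
  \<open>u\<^sup>* w\<close>.\<close>

definition inner_at :: "nat \<Rightarrow> complex vec \<Rightarrow> complex vec \<Rightarrow> complex vec \<Rightarrow> real" where
  "inner_at d v u w =
     Re (w \<bullet>c u + (of_nat d - 1) * (v \<bullet>c u) * (w \<bullet>c v) / complex_of_real ((cvec_norm v)\<^sup>2))"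

definition vec_R :: "complex vec \<Rightarrow> real vec" where
  "vec_R v = map_vec Re v @\<^sub>v map_vec Im v"

definition vec_I :: "complex vec \<Rightarrow> real vec" where
  "vec_I v = map_vec (\<lambda>z. - Im z) v @\<^sub>v map_vec Re v"

definition outer :: "real vec \<Rightarrow> real vec \<Rightarrow> real mat" where
  "outer x y = mat (dim_vec x) (dim_vec y) (\<lambda>(i, j). x $ i * y $ j)"

definition M_mat :: "nat \<Rightarrow> complex vec \<Rightarrow> real mat" where
  "M_mat d v = 1\<^sub>m (2 * dim_vec v) +
     ((real d - 1) / (cvec_norm v)\<^sup>2) \<cdot>\<^sub>m (outer (vec_R v) (vec_R v) + outer (vec_I v) (vec_I v))"

lemma vec_I_eq: "vec_I v = vec_R (\<i> \<cdot>\<^sub>v v)"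
  by (auto simp: vec_I_def vec_R_def append_vec_def Let_def)

lemma dim_vec_R [simp]: "dim_vec (vec_R v) = 2 * dim_vec v"
  and dim_vec_I [simp]: "dim_vec (vec_I v) = 2 * dim_vec v"
  by (simp_all add: vec_R_def vec_I_def)

lemma scalar_prod_vec_R:
  assumes "dim_vec a = dim_vec b"
  shows "vec_R a \<bullet> vec_R b = Re (b \<bullet>c a)"
proof -
  have "vec_R a \<bullet> vec_R b = map_vec Re a \<bullet> map_vec Re b + map_vec Im a \<bullet> map_vec Im b"
    unfolding vec_R_def 
    by (rule scalar_prod_append[of _ "dim_vec b" _ "dim_vec b"])
      (use assms in \<open>auto intro!: carrier_vecI\<close>)
  also have "\<dots> = Re (b \<bullet>c a)"
    using assms by (simp add: scalar_prod_def sum.distrib mult.commute)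
  finally show ?thesis .
qed

lemma scalar_prod_vec_I:
  assumes "dim_vec a = dim_vec b"
  shows "vec_R a \<bullet> vec_I b = - Im (b \<bullet>c a)"
  using assms by (simp add: vec_I_eq scalar_prod_vec_R)

lemma cscalar_prod_swap:
  assumes "dim_vec a = dim_vec (b :: complex vec)"
  shows "b \<bullet>c a = cnj (a \<bullet>c b)"
  using assms by (simp add: scalar_prod_def mult.commute)

lemma outer_mult_vec:
  assumes "dim_vec y = dim_vec z"
  shows "outer x y *\<^sub>v z = (y \<bullet> z) \<cdot>\<^sub>v x"
  using assms by (intro eq_vecI)
    (auto simp: outer_def scalar_prod_def sum_distrib_left sum_distrib_right mult_ac)

lemma inner_at_eq_M_mat:
  assumes "dim_vec u = dim_vec v" "dim_vec w = dim_vec v"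
  shows "inner_at d v u w = vec_R u \<bullet> (M_mat d v *\<^sub>v vec_R w)"
proof -
  let ?m = "2 * dim_vec v" and ?c = "(real d - 1) / (cvec_norm v)\<^sup>2"
  let ?x = "vec_R v" and ?y = "vec_I v"
  have W: "vec_R w \<in> carrier_vec ?m" and U: "vec_R u \<in> carrier_vec ?m"
    and X: "?x \<in> carrier_vec ?m" and Y: "?y \<in> carrier_vec ?m"
    using assms by (auto intro!: carrier_vecI)
  have O: "outer ?x ?x \<in> carrier_mat ?m ?m" "outer ?y ?y \<in> carrier_mat ?m ?m"
    by (auto simp: outer_def)
  have smult: "(k \<cdot>\<^sub>m A) *\<^sub>v z = k \<cdot>\<^sub>v (A *\<^sub>v z)" if "dim_col A = dim_vec z"
    for k and A :: "real mat" and z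
    using that by (intro eq_vecI) (auto simp: scalar_prod_def sum_distrib_left mult.assoc)
  have "M_mat d v *\<^sub>v vec_R w
      = vec_R w + ?c \<cdot>\<^sub>v ((?x \<bullet> vec_R w) \<cdot>\<^sub>v ?x + (?y \<bullet> vec_R w) \<cdot>\<^sub>v ?y)"
    unfolding M_mat_def using W O assms
    by (simp add: add_mult_distrib_mat_vec[of _ ?m ?m]
        outer_mult_vec smult)
  then have "vec_R u \<bullet> (M_mat d v *\<^sub>v vec_R w)
      = vec_R u \<bullet> vec_R w + ?c * ((?x \<bullet> vec_R w) * (vec_R u \<bullet> ?x)
          + (?y \<bullet> vec_R w) * (vec_R u \<bullet> ?y))"
    using W U X Y by (simp add: scalar_prod_add_distrib[of _ ?m])
  also have "?y \<bullet> vec_R w = Im (w \<bullet>c v)"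
    using scalar_prod_vec_I[of w v] assms comm_scalar_prod[OF Y W] cscalar_prod_swap[of w v]
    by simp
  also have "?x \<bullet> vec_R w = Re (w \<bullet>c v)"
    using assms by (simp add: scalar_prod_vec_R)
  also have "vec_R u \<bullet> ?y = - Im (v \<bullet>c u)"
    using assms by (simp add: scalar_prod_vec_I)
  also have "vec_R u \<bullet> ?x = Re (v \<bullet>c u)"
    using assms by (simp add: scalar_prod_vec_R)
  also have "vec_R u \<bullet> vec_R w = Re (w \<bullet>c u)"
    using assms by (simp add: scalar_prod_vec_R)
  finally show ?thesis
    by (simp add: inner_at_def Re_divide_of_real algebra_simps add_divide_distrib diff_divide_distrib)
qed

subsection \<open>Matrices\<close>

text \<open>The library predicate \<^const>\<open>orthogonal_mat\<close> does not require the columns to have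
  norm 1.\<close>

definition orthonormal_mat :: "real mat \<Rightarrow> bool" where
  "orthonormal_mat A \<longleftrightarrow> square_mat A \<and> transpose_mat A * A = 1\<^sub>m (dim_row A)"

definition permutation_mat :: "real mat \<Rightarrow> bool" where
  "permutation_mat P \<longleftrightarrow>
     (\<exists>p. p permutes {..<dim_row P} \<and>
          P = mat (dim_row P) (dim_row P) (\<lambda>(i, j). if i = p j then 1 else 0))"

text \<open>Only meaningful for a diagonal matrix with nonnegative entries.\<close>

definition diag_sqrt :: "real mat \<Rightarrow> real mat" where
  "diag_sqrt D = mat_diag (dim_row D) (\<lambda>i. sqrt (D $$ (i, i)))"

definition rank_revealing_qr :: "real mat \<Rightarrow> real mat \<Rightarrow> real mat \<Rightarrow> real mat \<Rightarrow> bool" where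
  "rank_revealing_qr A Q R P \<longleftrightarrow>
     (let m = dim_row A; \<rho> = vec_space.rank m A in
        {A, Q, R, P} \<subseteq> carrier_mat m m \<and> A = Q * R * P \<and>
        orthonormal_mat Q \<and> permutation_mat P \<and> upper_triangular R \<and>
        invertible_mat (mat \<rho> \<rho> (\<lambda>(i, j). R $$ (i, j))) \<and>
        (\<forall>i<m. \<forall>j<m. \<rho> \<le> i \<longrightarrow> R $$ (i, j) = 0))"

lemma diag_sqrt_square:
  assumes "\<And>i. i < m \<Longrightarrow> 0 \<le> f i"
  shows "diag_sqrt (mat_diag m f) * diag_sqrt (mat_diag m f) = mat_diag m f"
  by (rule eq_matI) (use assms in \<open>auto simp: diag_sqrt_def mat_diag_def scalar_prod_def
    if_distrib cong: if_cong\<close>)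

lemma mat_inverse_mat_diag:
  fixes f :: "nat \<Rightarrow> real"
  assumes "\<And>i. i < m \<Longrightarrow> f i \<noteq> 0"
  shows "mat_inverse (mat_diag m f) = Some (mat_diag m (\<lambda>i. inverse (f i)))"
proof -
  let ?D = "mat_diag m f" and ?E = "mat_diag m (\<lambda>i. inverse (f i))"
  have one: "mat_diag m g = 1\<^sub>m m" if "\<And>i. i < m \<Longrightarrow> g i = 1" for g :: "nat \<Rightarrow> real"
    by (rule eq_matI) (auto simp: mat_diag_def that)
  have DE: "?D * ?E = 1\<^sub>m m" and ED: "?E * ?D = 1\<^sub>m m"
    using assms by (auto intro!: one)
  have "?D \<in> Units (ring_mat TYPE(real) m ())"
    using DE ED by (auto simp: Units_def ring_mat_def intro!: bexI[of _ ?E])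
  then obtain B where B: "mat_inverse ?D = Some B"
    using mat_inverse(1)[of ?D m "()"] by fastforce
  have "?D * B = 1\<^sub>m m" "B \<in> carrier_mat m m"
    using mat_inverse(2)[OF _ B, of m] by auto
  then have "B = ?E"
    using ED assoc_mult_mat[of ?E m m ?D m B m]
    by (simp add: right_mult_one_mat[of _ m])
  with B show ?thesis by simp
qed

subsection \<open>Complex space as a real vector space\<close>

text \<open>The fields \<open>mult\<close> and \<open>one\<close> belong to the record type of modules but play no role in
  a module.\<close>

definition real_cvec_space :: "nat \<Rightarrow> (real, complex vec) module" where
  "real_cvec_space n = \<lparr>carrier = carrier_vec n, mult = undefined, one = undefined,
     zero = 0\<^sub>v n, add = (+), smult = (\<lambda>r x. complex_of_real r \<cdot>\<^sub>v x)\<rparr>"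

lemma vectorspace_real_cvec_space:
  "vectorspace (class_ring :: real ring) (real_cvec_space n)"
proof -
  interpret abelian_group "real_cvec_space n"
    apply unfold_locales
    unfolding real_cvec_space_def Units_def
    using add_inv_exists_vec by auto
  have "module (class_ring :: real ring) (real_cvec_space n)"
    using class_field[where 'a = real]
    by unfold_locales
      (auto simp: real_cvec_space_def class_ring_simps add_smult_distrib_vec smult_add_distrib_vec
        smult_smult_assoc field_def domain_def cring_def)
  then show ?thesis
    by (simp add: vectorspace_def class_field)
qed

definition orthonormal_real_basis ::
    "nat \<Rightarrow> (complex vec \<Rightarrow> complex vec \<Rightarrow> real) \<Rightarrow> 'i set \<Rightarrow> ('i \<Rightarrow> complex vec) \<Rightarrow> bool" where
  "orthonormal_real_basis n ip I u \<longleftrightarrow>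
     inj_on u I \<and> vectorspace.basis class_ring (real_cvec_space n) (u ` I) \<and>
     (\<forall>i\<in>I. \<forall>j\<in>I. ip (u i) (u j) = (if i = j then 1 else 0))"

end

theory Submission
  imports Defs
begin

text \<open>In the coordinates \<open>w = \<surd>S U\<^sup>t x\<close> on \<open>\<real>\<^sup>2\<^sup>n\<close>, the inner product with matrix
  \<open>M\<^sub>v = U S U\<^sup>t\<close> becomes the standard one (\<open>scalar_prod_whitened\<close>), and \<open>U \<surd>(S\<^sup>-\<^sup>1)\<close>
  is the inverse change of coordinates. Since \<open>v\<^sub>R / \<parallel>v\<parallel>\<close> is the first column of \<open>U\<close>, the
  coordinates of the first vector, which form \<open>uhat\<close>, are just the first unit
  vector \<open>e\<close>; the coordinates of the other vectors are the columns of \<open>Q\<close> except the last.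
  So it is enough that these columns are orthogonal to \<open>e\<close>.

  That holds because \<open>I - e e\<^sup>t\<close> is the orthogonal projection with kernel \<open>\<real>e\<close>, so its rank is
  deficient and the last row of \<open>R\<close> vanishes. Hence the last column of \<open>Q\<close> is orthogonal to
  the image, that is, a multiple of \<open>e\<close>, and the remaining columns are orthogonal to it
  (\<open>rank_revealing_qr_projection_cols\<close>).

  Finally, \<open>2n\<close> vectors that are orthonormal for a bilinear form on \<open>\<real>\<^sup>2\<^sup>n\<close> form a basis: the
  matrix of the vectors has a left inverse by orthonormality, and a one-sided inverse of a
  square matrix is two-sided (\<open>orthonormal_real_basisI\<close>).\<close>

lemma vec_R_carrier:
  "x \<in> carrier_vec n \<Longrightarrow> vec_R x \<in> carrier_vec (2 * n)"
  by (auto intro!: carrier_vecI)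

lemma vec_R_add:
  assumes "x \<in> carrier_vec n" "y \<in> carrier_vec n"
  shows "vec_R (x + y) = vec_R x + vec_R y"
  using assms by (intro eq_vecI) (auto simp: vec_R_def append_vec_def Let_def)

lemma vec_R_smult: "vec_R (complex_of_real r \<cdot>\<^sub>v x) = r \<cdot>\<^sub>v vec_R x"
  by (intro eq_vecI) (auto simp: vec_R_def append_vec_def Let_def)

lemma vec_R_zero: "vec_R (0\<^sub>v n) = 0\<^sub>v (2 * n)"
  by (intro eq_vecI) (auto simp: vec_R_def append_vec_def Let_def)

lemma vec_R_inj:
  assumes "x \<in> carrier_vec n" "y \<in> carrier_vec n" "vec_R x = vec_R y"
  shows "x = y"
proof (rule eq_vecI)
  fix i assume i: "i < dim_vec y"
  have Re: "Re (z $ i) = vec_R z $ i" and Im: "Im (z $ i) = vec_R z $ (n + i)"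
    if "z \<in> carrier_vec n" for z
    using that i assms(2) by (auto simp: vec_R_def append_vec_def Let_def)
  show "x $ i = y $ i"
    using assms by (simp add: complex_eq_iff Re Im)
qed (use assms in auto)

lemma vec_R_of_halves:
  assumes "x \<in> carrier_vec (2 * n)"
  shows "vec_R (map_vec complex_of_real (vec_first x n)
    + \<i> \<cdot>\<^sub>v map_vec complex_of_real (vec_last x n)) = x"
  using assms by (intro eq_vecI)
    (auto simp: vec_R_def append_vec_def Let_def vec_first_def vec_last_def)

text \<open>Linear combinations in \<^const>\<open>real_cvec_space\<close> are sums in an abstract module. Their
  real coordinates are ordinary sums, to which matrix arithmetic applies.\<close>

lemma vec_R_lincomb:
  assumes "finite B" "B \<subseteq> carrier_vec n"
  shows "module.lincomb (real_cvec_space n) a B \<in> carrier_vec n"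
    and "k < 2 * n \<Longrightarrow>
      vec_R (module.lincomb (real_cvec_space n) a B) $ k = (\<Sum>x\<in>B. a x * vec_R x $ k)"
proof -
  interpret V: vectorspace "class_ring :: real ring" "real_cvec_space n"
    by (rule vectorspace_real_cvec_space)
  have *: "V.lincomb a B \<in> carrier_vec n \<and>
      (\<forall>k<2 * n. vec_R (V.lincomb a B) $ k = (\<Sum>x\<in>B. a x * vec_R x $ k))"
    using assms
  proof (induction B rule: finite_induct)
    case empty
    have "V.lincomb a {} = 0\<^sub>v n"
      unfolding V.lincomb_def by (subst V.finsum_empty) (simp add: real_cvec_space_def)
    then show ?case by (simp add: vec_R_zero)
  next
    case (insert x B)
    then have x: "x \<in> carrier_vec n" and B: "B \<subseteq> carrier_vec n" by auto
    have "V.lincomb a (insert x B) = complex_of_real (a x) \<cdot>\<^sub>v x + V.lincomb a B"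
      unfolding V.lincomb_def
      by (subst V.finsum_insert) (use insert x B in \<open>auto simp: real_cvec_space_def\<close>)
    with insert x B show ?case
      by (auto simp: vec_R_add[of _ n] vec_R_smult vec_R_carrier)
  qed
  then show "V.lincomb a B \<in> carrier_vec n"
    and "k < 2 * n \<Longrightarrow> vec_R (V.lincomb a B) $ k = (\<Sum>x\<in>B. a x * vec_R x $ k)"
    by auto
qed

text \<open>Orthonormality says \<open>X\<^sup>t G X = 1\<close> for the matrix \<open>X\<close> whose columns are the real
  coordinates of the vectors. So \<open>X\<^sup>t G\<close> is a left inverse of \<open>X\<close>, which gives linear
  independence; as \<open>X\<close> is square, it is also a right inverse, which gives generation.\<close>

lemma orthonormal_real_basisI:
  assumes G: "G \<in> carrier_mat (2 * n) (2 * n)"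
    and ip: "\<And>x y. x \<in> carrier_vec n \<Longrightarrow> y \<in> carrier_vec n \<Longrightarrow>
      ip x y = vec_R x \<bullet> (G *\<^sub>v vec_R y)"
    and u: "\<And>i. i \<in> {1..2 * n} \<Longrightarrow> u i \<in> carrier_vec n"
    and on: "\<And>i j. i \<in> {1..2 * n} \<Longrightarrow> j \<in> {1..2 * n} \<Longrightarrow>
      ip (u i) (u j) = (if i = j then 1 else 0)"
  shows "orthonormal_real_basis n ip {1..2 * n} u"
proof -
  interpret V: vectorspace "class_ring :: real ring" "real_cvec_space n"
    by (rule vectorspace_real_cvec_space)
  let ?m = "2 * n" and ?I = "{1..2 * n}"
  define X where "X = mat ?m ?m (\<lambda>(k, i). vec_R (u (Suc i)) $ k)"
  define Y where "Y = transpose_mat X * G"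
  have X: "X \<in> carrier_mat ?m ?m" and Y: "Y \<in> carrier_mat ?m ?m"
    using G by (auto simp: X_def Y_def)
  have colX: "col X i = vec_R (u (Suc i))" if "i < ?m" for i
    using that u[of "Suc i"] by (intro eq_vecI) (auto simp: X_def)
  have YX: "Y * X = 1\<^sub>m ?m"
  proof (rule eq_matI)
    fix i j assume ij: "i < dim_row (1\<^sub>m ?m :: real mat)" "j < dim_col (1\<^sub>m ?m :: real mat)"
    have "(Y * X) $$ (i, j) = (transpose_mat X * (G * X)) $$ (i, j)"
      using X G by (simp add: Y_def)
    also have "\<dots> = col X i \<bullet> (G *\<^sub>v col X j)"
      using X G ij by (simp flip: col_mult2[of G ?m ?m X ?m])
    also have "\<dots> = ip (u (Suc i)) (u (Suc j))"
      using ij u[of "Suc i"] u[of "Suc j"] by (simp add: ip colX)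
    finally show "(Y * X) $$ (i, j) = 1\<^sub>m ?m $$ (i, j)"
      using ij by (simp add: on)
  qed (use X Y in auto)
  from mat_mult_left_right_inverse[OF Y X YX] have XY: "X * Y = 1\<^sub>m ?m" .
  have inj: "inj_on u ?I"
  proof (rule inj_onI)
    fix i j assume ij: "i \<in> ?I" "j \<in> ?I" "u i = u j"
    from on[OF ij(1) ij(1)] on[OF ij(1,2)] ij(3) show "i = j"
      by (simp split: if_splits)
  qed
  have uC: "u ` ?I \<subseteq> carrier_vec n" using u by auto
  \<comment> \<open>In real coordinates a linear combination of the vectors is a product with \<open>X\<close>.\<close>
  have lc: "vec_R (V.lincomb a (u ` ?I)) = X *\<^sub>v vec ?m (\<lambda>i. a (u (Suc i)))" for a
  proof (rule eq_vecI)
    fix k assume k: "k < dim_vec (X *\<^sub>v vec ?m (\<lambda>i. a (u (Suc i))))"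
    then have "vec_R (V.lincomb a (u ` ?I)) $ k = (\<Sum>x\<in>u ` ?I. a x * vec_R x $ k)"
      using X by (intro vec_R_lincomb(2) uC) auto
    also have "\<dots> = (\<Sum>i\<in>Suc ` {0..<?m}. a (u i) * vec_R (u i) $ k)"
      by (simp only: sum.reindex[OF inj] o_def image_Suc_atLeastLessThan)
         (simp add: atLeastLessThanSuc_atLeastAtMost)
    also have "\<dots> = (\<Sum>i\<in>{0..<?m}. a (u (Suc i)) * vec_R (u (Suc i)) $ k)"
      by (subst sum.reindex) simp_all
    finally show "vec_R (V.lincomb a (u ` ?I)) $ k = (X *\<^sub>v vec ?m (\<lambda>i. a (u (Suc i)))) $ k"
      using k X by (simp add: X_def scalar_prod_def mult.commute)
  qed (use X vec_R_lincomb(1)[OF _ uC, of a] in auto)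
  have lcC: "V.lincomb a (u ` ?I) \<in> carrier_vec n" for a
    by (rule vec_R_lincomb(1)[OF _ uC]) simp
  have "V.lin_indpt (u ` ?I)"
  proof (rule V.finite_lin_indpt2)
    fix a assume 0: "V.lincomb a (u ` ?I) = \<zero>\<^bsub>real_cvec_space n\<^esub>"
    let ?c = "vec ?m (\<lambda>i. a (u (Suc i)))"
    have "?c = (Y * X) *\<^sub>v ?c" by (simp add: YX)
    also have "\<dots> = Y *\<^sub>v (X *\<^sub>v ?c)" using X Y by (simp add: assoc_mult_mat_vec[of _ ?m ?m _ ?m])
    also have "X *\<^sub>v ?c = 0\<^sub>v ?m"
      using 0 by (simp flip: lc add: real_cvec_space_def vec_R_zero)
    also have "Y *\<^sub>v 0\<^sub>v ?m = 0\<^sub>v ?m" using Y by auto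
    finally have c: "?c = 0\<^sub>v ?m" .
    have "a (u (Suc i)) = 0" if "i < ?m" for i
      using arg_cong[OF c, of "\<lambda>x. x $ i"] that by simp
    then have "a (u i) = 0" if "i \<in> ?I" for i
      using that by (cases i) auto
    then show "\<forall>x\<in>u ` ?I. a x = \<zero>\<^bsub>class_ring\<^esub>"
      by (auto simp: class_ring_simps)
  qed (use uC in \<open>auto simp: real_cvec_space_def\<close>)
  moreover have "V.gen_set (u ` ?I)"
  proof
    show "V.span (u ` ?I) \<subseteq> carrier (real_cvec_space n)"
      by (rule V.span_is_subset2) (use uC in \<open>auto simp: real_cvec_space_def\<close>)
    show "carrier (real_cvec_space n) \<subseteq> V.span (u ` ?I)"
    proof
      fix w assume "w \<in> carrier (real_cvec_space n)"
      then have w: "w \<in> carrier_vec n" by (simp add: real_cvec_space_def)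
      \<comment> \<open>The coefficients of \<open>w\<close> in an orthonormal basis are its inner products.\<close>
      have "vec ?m (\<lambda>i. ip (u (Suc i)) w) = Y *\<^sub>v vec_R w"
      proof (rule eq_vecI)
        fix i assume i: "i < dim_vec (Y *\<^sub>v vec_R w)"
        then have i: "i < ?m" using Y by simp
        have "Y *\<^sub>v vec_R w = transpose_mat X *\<^sub>v (G *\<^sub>v vec_R w)"
          using X G w vec_R_carrier[OF w] by (simp add: Y_def assoc_mult_mat_vec[of _ ?m ?m _ ?m])
        then show "vec ?m (\<lambda>i. ip (u (Suc i)) w) $ i = (Y *\<^sub>v vec_R w) $ i"
          using i X w u[of "Suc i"] by (simp add: ip colX)
      qed (use Y in auto)
      then have "vec_R (V.lincomb (\<lambda>x. ip x w) (u ` ?I)) = X *\<^sub>v (Y *\<^sub>v vec_R w)"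
        by (simp only: lc)
      also have "\<dots> = (X * Y) *\<^sub>v vec_R w"
        using X Y vec_R_carrier[OF w] by (simp add: assoc_mult_mat_vec[of _ ?m ?m _ ?m])
      also have "\<dots> = vec_R w" using vec_R_carrier[OF w] by (simp add: XY)
      finally have "V.lincomb (\<lambda>x. ip x w) (u ` ?I) = w"
        using lcC w by (intro vec_R_inj)
      then show "w \<in> V.span (u ` ?I)"
        unfolding V.span_def
        by (intro CollectI exI[of _ "\<lambda>x. ip x w"] exI[of _ "u ` ?I"])
          (auto simp: class_ring_simps)
    qed
  qed
  ultimately have "V.basis (u ` ?I)"
    unfolding V.basis_def using uC by (simp add: real_cvec_space_def)
  with inj on show ?thesis
    by (simp add: orthonormal_real_basis_def)
qed

lemma orthonormal_mat_scalar_prod: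
  assumes A: "A \<in> carrier_mat m m" and "orthonormal_mat A"
    and x: "x \<in> carrier_vec m" and y: "y \<in> carrier_vec m"
  shows "(A *\<^sub>v x) \<bullet> (A *\<^sub>v y) = x \<bullet> y"
proof -
  have "x \<bullet> y = x \<bullet> ((transpose_mat A * A) *\<^sub>v y)"
    using assms by (simp add: orthonormal_mat_def)
  also have "\<dots> = (A *\<^sub>v x) \<bullet> (A *\<^sub>v y)"
    using A x y transpose_vec_mult_scalar[of A m m x "A *\<^sub>v y"]
    by (simp add: assoc_mult_mat_vec[of _ m m _ m] comm_scalar_prod[of _ m])
  finally show ?thesis by simp
qed

lemma mult_mat_unit_vec:
  fixes A :: "real mat"
  assumes "A \<in> carrier_mat m m" "j < m"
  shows "A *\<^sub>v unit_vec m j = col A j"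
  using assms by (intro eq_vecI) auto

lemma orthonormal_mat_col_scalar_prod:
  assumes "A \<in> carrier_mat m m" "orthonormal_mat A" "i < m" "x \<in> carrier_vec m"
  shows "col A i \<bullet> (A *\<^sub>v x) = x $ i"
  using assms orthonormal_mat_scalar_prod[of A m "unit_vec m i" x]
  by (simp add: mult_mat_unit_vec)

lemma orthonormal_mat_cols:
  assumes "A \<in> carrier_mat m m" "orthonormal_mat A" "i < m" "j < m"
  shows "col A i \<bullet> col A j = (if i = j then 1 else 0)"
  using assms orthonormal_mat_col_scalar_prod[of A m i "unit_vec m j"]
  by (simp add: mult_mat_unit_vec)

lemma projection_mult_vec:
  assumes "e \<in> carrier_vec m" "x \<in> carrier_vec m"
  shows "(1\<^sub>m m - outer e e) *\<^sub>v x = x - (e \<bullet> x) \<cdot>\<^sub>v e"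
proof -
  have "outer e e \<in> carrier_mat m m" using assms by (auto simp: outer_def)
  then show ?thesis
    using assms by (simp add: minus_mult_distrib_mat_vec[of _ m m] outer_mult_vec)
qed

text \<open>The matrix is the orthogonal projection along \<open>e\<close>. Its determinant is zero, so its rank
  is at most \<open>m - 1\<close> and the last row of \<open>R\<close> vanishes. Therefore the last column \<open>q\<close> of \<open>Q\<close>
  is orthogonal to every \<open>x - (e \<bullet> x) e\<close>. Taking \<open>x = q\<close> gives \<open>(e \<bullet> q)\<^sup>2 = 1\<close>, and
  taking \<open>x\<close> to be another column gives \<open>(e \<bullet> x) (e \<bullet> q) = 0\<close>, so \<open>e \<bullet> x = 0\<close>.\<close>

lemma rank_revealing_qr_projection_cols:
  assumes e: "e \<in> carrier_vec m" "e \<bullet> e = 1"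
    and qr: "rank_revealing_qr (1\<^sub>m m - outer e e) Q R P"
    and j: "Suc j < m"
  shows "col Q j \<bullet> e = 0"
proof -
  let ?A = "1\<^sub>m m - outer e e" and ?k = "m - 1"
  have A: "?A \<in> carrier_mat m m" using e by (auto simp: outer_def)
  have "?A *\<^sub>v e = 0\<^sub>v m" using e by (simp add: projection_mult_vec)
  moreover have "e \<noteq> 0\<^sub>v m" using e by auto
  ultimately have "det ?A = 0"
    using det_0_iff_vec_prod_zero[OF A] e(1) by blast
  then have rank: "vec_space.rank m ?A \<le> ?k"
    using vec_space.det_zero_low_rank[OF A] by simp
  from qr A have Q: "Q \<in> carrier_mat m m" and R: "R \<in> carrier_mat m m"
    and P: "P \<in> carrier_mat m m" and AQ: "?A = Q * R * P" and oQ: "orthonormal_mat Q"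
    and zero: "\<forall>i<m. \<forall>j<m. vec_space.rank m ?A \<le> i \<longrightarrow> R $$ (i, j) = 0"
    unfolding rank_revealing_qr_def Let_def by auto
  have k: "?k < m" using j by simp
  have rowR: "row R ?k = 0\<^sub>v m"
    using zero rank k R by (intro eq_vecI) auto
  \<comment> \<open>In the basis of the columns of \<open>Q\<close>, the last coefficient of a vector in the image is
    the last entry of a product with \<open>R\<close>.\<close>
  have last: "col Q ?k \<bullet> (x - (e \<bullet> x) \<cdot>\<^sub>v e) = 0" if x: "x \<in> carrier_vec m" for x
  proof -
    have Px: "P *\<^sub>v x \<in> carrier_vec m" using P x by simp
    have "x - (e \<bullet> x) \<cdot>\<^sub>v e = Q *\<^sub>v (R *\<^sub>v (P *\<^sub>v x))"
      using Q R P x Px e(1)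
      by (simp flip: projection_mult_vec add: AQ assoc_mult_mat_vec[of _ m m _ m])
    then have "col Q ?k \<bullet> (x - (e \<bullet> x) \<cdot>\<^sub>v e) = (R *\<^sub>v (P *\<^sub>v x)) $ ?k"
      using Q R Px k oQ by (simp add: orthonormal_mat_col_scalar_prod)
    then show ?thesis using R k Px rowR by simp
  qed
  have expand: "col Q ?k \<bullet> col Q i = (e \<bullet> col Q i) * (col Q ?k \<bullet> e)" if i: "i < m" for i
  proof -
    have "col Q i \<in> carrier_vec m" "col Q ?k \<in> carrier_vec m" using Q by auto
    with last[of "col Q i"] e(1) show ?thesis
      by (simp add: scalar_prod_minus_distrib[of _ m])
  qed
  have "col Q ?k \<bullet> col Q ?k = 1" "col Q ?k \<bullet> col Q j = 0"
    using j k by (simp_all add: orthonormal_mat_cols[OF Q oQ])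
  then have "(e \<bullet> col Q ?k) * (col Q ?k \<bullet> e) = 1" "(e \<bullet> col Q j) * (col Q ?k \<bullet> e) = 0"
    using expand[of ?k] expand[of j] j k by simp_all
  then have "e \<bullet> col Q j = 0" by auto
  then show ?thesis
    using e(1) Q j comm_scalar_prod[of e m "col Q j"] by (auto intro: carrier_vecI)
qed

lemma mat_diag_mult_vec_index:
  fixes f :: "nat \<Rightarrow> real"
  assumes "x \<in> carrier_vec m" "i < m"
  shows "(mat_diag m f *\<^sub>v x) $ i = f i * x $ i"
proof -
  have "(mat_diag m f *\<^sub>v x) $ i = (\<Sum>k = 0..<m. (if i = k then f k else 0) * x $ k)"
    using assms by (simp add: mat_diag_def scalar_prod_def)
  also have "\<dots> = (\<Sum>k = 0..<m. if k = i then f i * x $ i else 0)"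
    by (intro sum.cong) auto
  finally show ?thesis using assms by simp
qed

text \<open>The map \<open>a \<mapsto> U (diag t) a\<close> is an isometry from the standard inner product to the one
  with matrix \<open>U (diag f) U\<^sup>t\<close>: the factors \<open>U\<close> cancel by orthogonality and the diagonal
  factors because \<open>t\<close> is, up to sign, the inverse square root of \<open>f\<close>.\<close>

lemma scalar_prod_whitened:
  fixes f t :: "nat \<Rightarrow> real"
  assumes U: "U \<in> carrier_mat m m" "orthonormal_mat U"
    and tf: "\<And>i. i < m \<Longrightarrow> f i * (t i)\<^sup>2 = 1"
    and a: "a \<in> carrier_vec m" and b: "b \<in> carrier_vec m"
  shows "(U *\<^sub>v (mat_diag m t *\<^sub>v a)) \<bullet>
    ((U * mat_diag m f * transpose_mat U) *\<^sub>v (U *\<^sub>v (mat_diag m t *\<^sub>v b))) = a \<bullet> b"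
proof -
  let ?F = "mat_diag m f" and ?a = "mat_diag m t *\<^sub>v a" and ?b = "mat_diag m t *\<^sub>v b"
  have F: "?F \<in> carrier_mat m m" by simp
  have ab: "?a \<in> carrier_vec m" "?b \<in> carrier_vec m"
    using a b by (auto intro: mult_mat_vec_carrier[OF mat_diag_dim])
  have Fb: "?F *\<^sub>v ?b \<in> carrier_vec m" by (rule mult_mat_vec_carrier[OF F ab(2)])
  have "transpose_mat U *\<^sub>v (U *\<^sub>v ?b) = (transpose_mat U * U) *\<^sub>v ?b"
    using U(1) ab by (simp add: assoc_mult_mat_vec[of _ m m _ m])
  also have "\<dots> = ?b" using U ab by (simp add: orthonormal_mat_def)
  finally have "(U * ?F * transpose_mat U) *\<^sub>v (U *\<^sub>v ?b) = U *\<^sub>v (?F *\<^sub>v ?b)"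
    using U(1) ab F by (simp add: assoc_mult_mat_vec[of _ m m _ m])
  then have "(U *\<^sub>v ?a) \<bullet> ((U * ?F * transpose_mat U) *\<^sub>v (U *\<^sub>v ?b)) = ?a \<bullet> (?F *\<^sub>v ?b)"
    using orthonormal_mat_scalar_prod[OF U ab(1) Fb] by simp
  also have "\<dots> = (\<Sum>i = 0..<m. (t i * a $ i) * (f i * (t i * b $ i)))"
    unfolding scalar_prod_def
    by (rule sum.cong)
      (use a b ab in \<open>simp_all add: mat_diag_mult_vec_index carrier_matD[OF mat_diag_dim]
        del: index_mult_mat_vec\<close>)
  also have "\<dots> = (\<Sum>i = 0..<m. (f i * (t i)\<^sup>2) * (a $ i * b $ i))"
    by (simp add: power2_eq_square mult_ac)
  also have "\<dots> = a \<bullet> b" using b tf by (simp add: scalar_prod_def)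
  finally show ?thesis .
qed

theorem lemma4p8:
  fixes d n :: nat
    and v :: "complex vec"
    and U S Q R P :: "real mat"
    and uhat :: "real vec"
    and uR :: "nat \<Rightarrow> real vec"
    and u :: "nat \<Rightarrow> complex vec"
  assumes "d > 2"
    and "v \<in> carrier_vec n" and "v \<noteq> 0\<^sub>v n"
    and "U \<in> carrier_mat (2 * n) (2 * n)" and "orthonormal_mat U"
    and "col U 0 = (1 / cvec_norm v) \<cdot>\<^sub>v vec_R v"
    and "col U 1 = (1 / cvec_norm v) \<cdot>\<^sub>v vec_I v"
    and "S = mat_diag (2 * n) (\<lambda>i. if i < 2 then real d else 1)"
    and "M_mat d v = U * S * transpose_mat U"
    and "uhat = diag_sqrt S *\<^sub>v (transpose_mat U *\<^sub>v
                  ((1 / (sqrt (real d) * cvec_norm v)) \<cdot>\<^sub>v vec_R v))"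
    and "rank_revealing_qr (1\<^sub>m (2 * n) - outer uhat uhat) Q R P"
    and "uR 1 = (1 / (sqrt (real d) * cvec_norm v)) \<cdot>\<^sub>v vec_R v"
    and "\<forall>i\<in>{2..2 * n}. uR i = U *\<^sub>v (diag_sqrt (the (mat_inverse S)) *\<^sub>v col Q (i - 2))"
    and "\<forall>i\<in>{1..2 * n}. u i = map_vec complex_of_real (vec_first (uR i) n)
                              + \<i> \<cdot>\<^sub>v map_vec complex_of_real (vec_last (uR i) n)"
  shows "orthonormal_real_basis n (inner_at d v) {1..2 * n} u"
proof -
  let ?m = "2 * n"
  define f :: "nat \<Rightarrow> real" where "f i = (if i < 2 then real d else 1)" for i
  define t where "t i = sqrt (inverse (f i))" for i
  have f: "f i > 0" for i using \<open>d > 2\<close> by (simp add: f_def)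
  have tf: "f i * (t i)\<^sup>2 = 1" for i using f[of i] by (simp add: t_def)
  have S: "S = mat_diag ?m f" using assms(8) by (simp add: f_def[abs_def])
  have sqrt_S: "diag_sqrt S = mat_diag ?m (\<lambda>i. sqrt (f i))"
    and sqrt_S_inv: "diag_sqrt (the (mat_inverse S)) = mat_diag ?m t"
    using f mat_inverse_mat_diag[of ?m f]
    by (auto simp: S diag_sqrt_def t_def mat_diag_def less_imp_neq[OF f, symmetric] intro!: eq_matI)
  \<comment> \<open>In dimension zero every vector is zero.\<close>
  have n: "0 < n"
    using assms(2,3) by (cases n) auto
  let ?e = "unit_vec ?m 0 :: real vec"
  have U: "U \<in> carrier_mat ?m ?m" and oU: "orthonormal_mat U" by fact+
  have x1: "(1 / (sqrt (real d) * cvec_norm v)) \<cdot>\<^sub>v vec_R v = (1 / sqrt (real d)) \<cdot>\<^sub>v col U 0"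
    by (simp add: assms(6) smult_smult_assoc)
  have Ue: "transpose_mat U *\<^sub>v col U 0 = ?e"
    using U n orthonormal_mat_cols[OF U oU]
    by (intro eq_vecI) auto
  have "transpose_mat U *\<^sub>v ((1 / sqrt (real d)) \<cdot>\<^sub>v col U 0) = (1 / sqrt (real d)) \<cdot>\<^sub>v ?e"
    using U n by (subst mult_mat_vec[of _ ?m ?m]) (auto simp: Ue intro!: carrier_vecI)
  then have "uhat = mat_diag ?m (\<lambda>i. sqrt (f i)) *\<^sub>v ((1 / sqrt (real d)) \<cdot>\<^sub>v ?e)"
    by (simp add: assms(10) sqrt_S x1)
  also have "\<dots> = ?e"
    using \<open>d > 2\<close> n
    by (intro eq_vecI) (simp_all add: mat_diag_mult_vec_index f_def mat_diag_def)
  finally have uhat: "uhat = ?e" .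
  from assms(11) have qr: "rank_revealing_qr (1\<^sub>m ?m - outer ?e ?e) Q R P"
    by (simp add: uhat)
  then have Q: "Q \<in> carrier_mat ?m ?m" and oQ: "orthonormal_mat Q"
    unfolding rank_revealing_qr_def Let_def by (auto simp: outer_def)
  have colQ: "col Q i \<in> carrier_vec ?m" for i using Q by (auto intro!: carrier_vecI)
  \<comment> \<open>The vectors in the coordinates in which the inner product is the standard one;
    number 2 belongs to the first column of \<open>Q\<close>, which has index 0.\<close>
  define w where "w i = (if i = 1 then ?e else col Q (i - 2))" for i :: nat
  have w: "w i \<in> carrier_vec ?m" for i using colQ by (simp add: w_def)
  have ww: "w i \<bullet> w j = (if i = j then 1 else 0)"
    if "i \<in> {1..?m}" "j \<in> {1..?m}" for i j
  proof -
    have Qe: "col Q (k - 2) \<bullet> ?e = 0" if "k \<in> {2..?m}" for k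
      by (rule rank_revealing_qr_projection_cols[OF _ _ qr]) (use that n in auto)
    have eQ: "?e \<bullet> col Q (k - 2) = 0" if "k \<in> {2..?m}" for k
      using Qe[OF that] comm_scalar_prod[OF unit_vec_carrier colQ, of 0 "k - 2"] by simp
    show ?thesis
      using that n Qe[of i] eQ[of j] orthonormal_mat_cols[OF Q oQ, of "i - 2" "j - 2"]
      by (auto simp: w_def)
  qed
  have uR: "uR i = U *\<^sub>v (mat_diag ?m t *\<^sub>v w i)" if i: "i \<in> {1..?m}" for i
  proof (cases "i = 1")
    case True
    have "mat_diag ?m t *\<^sub>v ?e = (1 / sqrt (real d)) \<cdot>\<^sub>v ?e"
      using n by (intro eq_vecI)
        (simp_all add: mat_diag_mult_vec_index t_def f_def mat_diag_def
          real_sqrt_divide inverse_eq_divide)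
    then have "U *\<^sub>v (mat_diag ?m t *\<^sub>v ?e) = (1 / sqrt (real d)) \<cdot>\<^sub>v col U 0"
      using n by (simp only: mult_mat_vec[OF U unit_vec_carrier])
        (simp add: mult_mat_unit_vec[OF U])
    also have "\<dots> = uR 1" using assms(12) x1 by simp
    finally show ?thesis using True by (simp only: w_def if_True simp_thms)
  next
    case False
    with i assms(13) show ?thesis by (simp add: w_def sqrt_S_inv)
  qed
  have uRC: "uR i \<in> carrier_vec ?m" if "i \<in> {1..?m}" for i
    using U uR[OF that] by (auto intro!: carrier_vecI)
  have vec_R_u: "vec_R (u i) = uR i" if "i \<in> {1..?m}" for i
    using assms(14) that vec_R_of_halves[OF uRC[OF that]] by simp
  have uC: "u i \<in> carrier_vec n" if "i \<in> {1..?m}" for i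
    using assms(14) that by (auto intro!: carrier_vecI)
  have M: "M_mat d v = U * mat_diag ?m f * transpose_mat U"
    using assms(9) by (simp add: S)
  have ip: "inner_at d v x y = vec_R x \<bullet> (M_mat d v *\<^sub>v vec_R y)"
    if "x \<in> carrier_vec n" "y \<in> carrier_vec n" for x y
    using that assms(2) by (intro inner_at_eq_M_mat) auto
  show ?thesis
  proof (rule orthonormal_real_basisI)
    show "M_mat d v \<in> carrier_mat ?m ?m" using U unfolding M by auto
    fix i j assume ij: "i \<in> {1..?m}" "j \<in> {1..?m}"
    then show "inner_at d v (u i) (u j) = (if i = j then 1 else 0)"
      using scalar_prod_whitened[OF U oU tf w[of i] w[of j]] ww[OF ij]
      by (simp add: ip uC vec_R_u uR M)
  qed (use ip uC in auto)
qed

end
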